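(* The birational map $\zeta=\varphi\tau\mu_{14}$ on $X_4$ defined in the context has infinite order (as an element of the group $\mathrm{Bir}(X_4)$ of birational maps on $X_4$).
   Context: $X_4$ is the affine variety over $\mathbb{Q}$ in coordinates $(x_1,x_2,x_3,x_4)$ defined by $x_4^2-2x_3^2+x_2^2=2$ and $x_3^2-2x_2^2+x_1^2=2$. Rational maps on $X_4$ are identified when they agree on a dense open subset of $X_4$. Products of maps denote composition. Let $\tau(a,b,c,d)=(d,c,b,a)$ and $\mu_{14}(a,b,c,d)=(-a,b,c,-d)$. Let $\varphi=\left(\frac{p_1}{q},\frac{p_2}{q},\frac{p_3}{q},\frac{p_4}{q}\right)$, where, in the variables $(a,b,c,d)$, $$q=(b-c)^2(a-2b+c),$$ $$p_1=-2ab^3+ab^2c+2ab^2d+4abc^2-5abcd+ab-2ac^3+2ac^2d+ac-ad+3b^4-2b^3c-3b^3d-6b^2c^2+8b^2cd+b^2+4bc^3-4bc^2d-5bc+bd+c^2+cd-2,$$ $$p_2=-2ab^2c+5abc^2-2abcd+2ab-2ac^3+ac^2d-ad+3b^3c-8b^2c^2+3b^2cd-2b^2+4bc^3-2bc^2d-bc+2bd-2,$$ $$p_3=-2ab^3+5ab^2c-2ab^2d-2abc^2+abcd+3ab-ac-ad+3b^4-8b^3c+3b^3d+4b^2c^2-2b^2cd-3b^2-bc+3bd+c^2-cd-2,$$ $$p_4=-3ab^3+8ab^2c-3ab^2d-4abc^2+2abcd+4ab-2ac-ad+4b^4-10b^3c+4b^3d+2b^2c^2-2b^2cd-4b^2+5bc^3-2bc^2d-bc+4bd-2c^4+c^3d+2c^2-2cd-2.$$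 Then $\varphi$ is a birational map on $X_4$, and $\zeta=\varphi\tau\mu_{14}$, i.e. $\zeta(a,b,c,d)=\varphi(-d,c,b,-a)$. *)

theory Defs
  imports "HOL-Analysis.Analysis" "HOL-Algebra.Group"
begin

section \<open>Varieties over \<open>\<rat>\<close> in affine 4-space\<close>

text \<open>
  A variety over \<open>\<rat>\<close> is represented by its set of complex points, equipped with the topology
  whose closed sets are the zero loci of polynomials with \<^emph>\<open>rational\<close> coefficients. By the
  Nullstellensatz its open sets are those of the scheme over \<open>\<rat>\<close>, and a regular function over
  \<open>\<rat>\<close> is determined by its values on complex points. (Rational points alone would not do in
  general.) Since the complex numbers are infinite, polynomials may be represented as functions.
\<close>

type_synonym pt = "complex \<times> complex \<times> complex \<times> complex"

definition coords :: "(pt \<Rightarrow> complex) set" where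
  "coords = {\<lambda>(a, b, c, d). a, \<lambda>(a, b, c, d). b, \<lambda>(a, b, c, d). c, \<lambda>(a, b, c, d). d}"

inductive_set ratpoly :: "(pt \<Rightarrow> complex) set" where
  const: "(\<lambda>_. of_rat r) \<in> ratpoly"
| coord: "u \<in> coords \<Longrightarrow> u \<in> ratpoly"
| add: "p \<in> ratpoly \<Longrightarrow> q \<in> ratpoly \<Longrightarrow> (\<lambda>x. p x + q x) \<in> ratpoly"
| mult: "p \<in> ratpoly \<Longrightarrow> q \<in> ratpoly \<Longrightarrow> (\<lambda>x. p x * q x) \<in> ratpoly"

definition zariski :: "pt set \<Rightarrow> pt topology" where
  "zariski X = topology (\<lambda>U. \<exists>P \<subseteq> ratpoly. U = {x \<in> X. \<exists>p\<in>P. p x \<noteq> 0})"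

lemma openin_zariski:
  "openin (zariski X) U \<longleftrightarrow> (\<exists>P \<subseteq> ratpoly. U = {x \<in> X. \<exists>p\<in>P. p x \<noteq> 0})"
proof -
  let ?O = "\<lambda>U. \<exists>P \<subseteq> ratpoly. U = {x \<in> X. \<exists>p\<in>P. p x \<noteq> 0}"
  have "istopology ?O"
    unfolding istopology_def
  proof (intro conjI allI impI)
    fix S T assume "?O S" "?O T"
    from \<open>?O S\<close> obtain P where P: "P \<subseteq> ratpoly" "S = {x \<in> X. \<exists>p\<in>P. p x \<noteq> 0}" by (elim exE conjE)
    from \<open>?O T\<close> obtain Q where Q: "Q \<subseteq> ratpoly" "T = {x \<in> X. \<exists>p\<in>Q. p x \<noteq> 0}" by (elim exE conjE)
    let ?R = "{\<lambda>x. p x * q x |p q. p \<in> P \<and> q \<in> Q}"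
    have "?R \<subseteq> ratpoly" using P(1) Q(1) by (auto intro: ratpoly.mult)
    moreover have "S \<inter> T = {x \<in> X. \<exists>p\<in>?R. p x \<noteq> 0}" unfolding P(2) Q(2)
    proof (intro equalityI subsetI)
      fix x assume "x \<in> {x \<in> X. \<exists>p\<in>P. p x \<noteq> 0} \<inter> {x \<in> X. \<exists>p\<in>Q. p x \<noteq> 0}"
      then obtain p q where "x \<in> X" "p \<in> P" "p x \<noteq> 0" "q \<in> Q" "q x \<noteq> 0" by blast
      then show "x \<in> {x \<in> X. \<exists>p\<in>?R. p x \<noteq> 0}"
        by (intro CollectI conjI bexI[of _ "\<lambda>x. p x * q x"] exI[of _ p] exI[of _ q]) auto
    qed auto
    ultimately show "?O (S \<inter> T)" by (intro exI conjI)
  next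
    fix K assume K: "\<forall>S\<in>K. ?O S"
    let ?R = "{p \<in> ratpoly. {x \<in> X. p x \<noteq> 0} \<subseteq> \<Union>K}"
    have "\<Union>K = {x \<in> X. \<exists>p\<in>?R. p x \<noteq> 0}"
    proof (intro equalityI subsetI)
      fix x assume "x \<in> \<Union>K"
      then obtain S where S: "S \<in> K" "x \<in> S" by blast
      from K S(1) have "?O S" by (rule bspec)
      then obtain P where P: "P \<subseteq> ratpoly" "S = {x \<in> X. \<exists>p\<in>P. p x \<noteq> 0}" by (elim exE conjE)
      with S obtain p where p: "p \<in> P" "p x \<noteq> 0" "x \<in> X" by auto
      have "{x \<in> X. p x \<noteq> 0} \<subseteq> S" unfolding P(2) using p(1) by auto
      then have "p \<in> ?R" using P(1) S(1) p(1) by auto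
      with p show "x \<in> {x \<in> X. \<exists>p\<in>?R. p x \<noteq> 0}" by auto
    qed auto
    moreover have "?R \<subseteq> ratpoly" by auto
    ultimately show "?O (\<Union>K)" by (intro exI conjI)
  qed
  then show ?thesis by (simp add: zariski_def topology_inverse')
qed

definition dense_open :: "pt set \<Rightarrow> pt set \<Rightarrow> bool" where
  "dense_open X U \<longleftrightarrow> openin (zariski X) U \<and> zariski X closure_of U = topspace (zariski X)"

definition regular_fun :: "pt set \<Rightarrow> pt set \<Rightarrow> (pt \<Rightarrow> complex) \<Rightarrow> bool" where
  "regular_fun X U h \<longleftrightarrow>
     (\<forall>x\<in>U. \<exists>W p q. openin (zariski X) W \<and> x \<in> W \<and> W \<subseteq> U \<and> p \<in> ratpoly \<and> q \<in> ratpoly \<and>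
        (\<forall>y\<in>W. q y \<noteq> 0 \<and> h y = p y / q y))"

section \<open>Rational self-maps and the group of birational maps\<close>

definition rat_rep :: "pt set \<Rightarrow> (pt \<rightharpoonup> pt) \<Rightarrow> bool" where
  "rat_rep X f \<longleftrightarrow> dense_open X (dom f) \<and> ran f \<subseteq> X \<and>
     (\<forall>u\<in>coords. regular_fun X (dom f) (\<lambda>x. u (the (f x))))"

definition rat_eq :: "pt set \<Rightarrow> ((pt \<rightharpoonup> pt) \<times> (pt \<rightharpoonup> pt)) set" where
  "rat_eq X = {(f, g). rat_rep X f \<and> rat_rep X g \<and>
     (\<exists>W. dense_open X W \<and> W \<subseteq> dom f \<inter> dom g \<and> (\<forall>x\<in>W. f x = g x))}"

definition rat_class :: "pt set \<Rightarrow> (pt \<rightharpoonup> pt) \<Rightarrow> (pt \<rightharpoonup> pt) set" where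
  "rat_class X f = rat_eq X `` {f}"

definition rational_maps :: "pt set \<Rightarrow> (pt \<rightharpoonup> pt) set set" where
  "rational_maps X = Collect (rat_rep X) // rat_eq X"

text \<open>
  The composite \<open>f \<circ>\<^sub>m g\<close> is defined on the preimage of \<open>dom f\<close> under \<open>g\<close>. If this is not dense,
  then \<open>f \<circ>\<^sub>m g\<close> is not a representative and its class is empty; hence \<open>rat_comp X F G = {}\<close>
  (which is not a rational map) when \<open>F\<close> and \<open>G\<close> are not composable.
\<close>

definition rat_comp :: "pt set \<Rightarrow> (pt \<rightharpoonup> pt) set \<Rightarrow> (pt \<rightharpoonup> pt) set \<Rightarrow> (pt \<rightharpoonup> pt) set" where
  "rat_comp X F G = (\<Union>f\<in>F. \<Union>g\<in>G. rat_class X (f \<circ>\<^sub>m g))"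

definition rat_id :: "pt set \<Rightarrow> (pt \<rightharpoonup> pt) set" where
  "rat_id X = rat_class X (Some |` X)"

definition birational :: "pt set \<Rightarrow> (pt \<rightharpoonup> pt) set \<Rightarrow> bool" where
  "birational X F \<longleftrightarrow> F \<in> rational_maps X \<and>
     (\<exists>G\<in>rational_maps X. rat_comp X F G = rat_id X \<and> rat_comp X G F = rat_id X)"

definition Bir :: "pt set \<Rightarrow> (pt \<rightharpoonup> pt) set monoid" where
  "Bir X = \<lparr>carrier = {F. birational X F}, mult = rat_comp X, one = rat_id X\<rparr>"

subsection \<open>The birational maps form a group\<close>

lemma topspace_zariski [simp]: "topspace (zariski X) = X"
proof -
  have "openin (zariski X) X"
    unfolding openin_zariski
    by (rule exI[of _ "{\<lambda>_. of_rat 1}"]) (auto intro: ratpoly.const simp del: of_rat_1)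
  moreover have "\<And>U. openin (zariski X) U \<Longrightarrow> U \<subseteq> X" by (auto simp: openin_zariski)
  ultimately show ?thesis by (simp add: openin_subset openin_topspace subset_antisym)
qed

lemma open_subset_X: "openin (zariski X) U \<Longrightarrow> U \<subseteq> X"
  using openin_subset by fastforce

lemma open_nonzero: "p \<in> ratpoly \<Longrightarrow> openin (zariski X) {x \<in> X. p x \<noteq> 0}"
  unfolding openin_zariski by (rule exI[of _ "{p}"]) auto

lemma dense_open_iff:
  "dense_open X U \<longleftrightarrow> openin (zariski X) U \<and> (\<forall>T. openin (zariski X) T \<and> T \<noteq> {} \<longrightarrow> U \<inter> T \<noteq> {})"
  unfolding dense_open_def by (simp add: dense_intersects_open del: topspace_zariski)

lemma dense_open_Int:
  assumes "dense_open X U" "dense_open X V" shows "dense_open X (U \<inter> V)"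
proof -
  have "U \<inter> V \<inter> T \<noteq> {}" if T: "openin (zariski X) T" "T \<noteq> {}" for T
  proof -
    have "openin (zariski X) (V \<inter> T)" "V \<inter> T \<noteq> {}" using assms(2) T by (auto simp: dense_open_iff)
    then show ?thesis using assms(1) by (auto simp: dense_open_iff Int_assoc)
  qed
  then show ?thesis using assms unfolding dense_open_iff by auto
qed

lemma dense_open_mono:
  "dense_open X U \<Longrightarrow> openin (zariski X) V \<Longrightarrow> U \<subseteq> V \<Longrightarrow> dense_open X V"
  unfolding dense_open_iff by blast

lemma dense_open_X: "dense_open X X"
  unfolding dense_open_iff using openin_topspace[of "zariski X"] open_subset_X by auto

lemma regular_funI:
  assumes "\<And>x. x \<in> U \<Longrightarrow> \<exists>W p q. openin (zariski X) W \<and> x \<in> W \<and> W \<subseteq> U \<and> p \<in> ratpoly \<and> q \<in> ratpoly \<and>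
        (\<forall>y\<in>W. q y \<noteq> 0 \<and> h y = p y / q y)"
  shows "regular_fun X U h"
  using assms unfolding regular_fun_def by blast

lemma regular_funE:
  assumes "regular_fun X U h" "x \<in> U"
  obtains W p q where "openin (zariski X) W" "x \<in> W" "W \<subseteq> U" "p \<in> ratpoly" "q \<in> ratpoly"
    "\<And>y. y \<in> W \<Longrightarrow> q y \<noteq> 0" "\<And>y. y \<in> W \<Longrightarrow> h y = p y / q y"
proof -
  obtain W p q where "openin (zariski X) W \<and> x \<in> W \<and> W \<subseteq> U \<and> p \<in> ratpoly \<and> q \<in> ratpoly \<and>
        (\<forall>y\<in>W. q y \<noteq> 0 \<and> h y = p y / q y)"
    using bspec[OF assms(1)[unfolded regular_fun_def] assms(2)] by (elim exE)
  then show thesis by (intro that[of W p q]) auto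
qed

lemma regular_ratpoly:
  assumes "openin (zariski X) U" "p \<in> ratpoly" shows "regular_fun X U p"
proof (rule regular_funI)
  fix x assume "x \<in> U"
  then show "\<exists>W p' q. openin (zariski X) W \<and> x \<in> W \<and> W \<subseteq> U \<and> p' \<in> ratpoly \<and> q \<in> ratpoly \<and>
        (\<forall>y\<in>W. q y \<noteq> 0 \<and> p y = p' y / q y)"
    using assms ratpoly.const[of 1]
    by (intro exI[of _ U] exI[of _ p] exI[of _ "\<lambda>_. of_rat 1"]) auto
qed

lemma regular_add:
  assumes "regular_fun X U h" "regular_fun X U k" shows "regular_fun X U (\<lambda>x. h x + k x)"
proof (rule regular_funI)
  fix x assume x: "x \<in> U"
  obtain W p q where W: "openin (zariski X) W" "x \<in> W" "W \<subseteq> U" "p \<in> ratpoly" "q \<in> ratpoly"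
    "\<And>y. y \<in> W \<Longrightarrow> q y \<noteq> 0" "\<And>y. y \<in> W \<Longrightarrow> h y = p y / q y" using regular_funE[OF assms(1) x] by blast
  obtain V r s where V: "openin (zariski X) V" "x \<in> V" "V \<subseteq> U" "r \<in> ratpoly" "s \<in> ratpoly"
    "\<And>y. y \<in> V \<Longrightarrow> s y \<noteq> 0" "\<And>y. y \<in> V \<Longrightarrow> k y = r y / s y" using regular_funE[OF assms(2) x] by blast
  show "\<exists>W p q. openin (zariski X) W \<and> x \<in> W \<and> W \<subseteq> U \<and> p \<in> ratpoly \<and> q \<in> ratpoly \<and>
        (\<forall>y\<in>W. q y \<noteq> 0 \<and> h y + k y = p y / q y)"
    using W V
    by (intro exI[of _ "W \<inter> V"] exI[of _ "\<lambda>y. p y * s y + r y * q y"] exI[of _ "\<lambda>y. q y * s y"])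
       (auto intro!: ratpoly.add ratpoly.mult simp: add_frac_eq)
qed

lemma regular_mult:
  assumes "regular_fun X U h" "regular_fun X U k" shows "regular_fun X U (\<lambda>x. h x * k x)"
proof (rule regular_funI)
  fix x assume x: "x \<in> U"
  obtain W p q where W: "openin (zariski X) W" "x \<in> W" "W \<subseteq> U" "p \<in> ratpoly" "q \<in> ratpoly"
    "\<And>y. y \<in> W \<Longrightarrow> q y \<noteq> 0" "\<And>y. y \<in> W \<Longrightarrow> h y = p y / q y" using regular_funE[OF assms(1) x] by blast
  obtain V r s where V: "openin (zariski X) V" "x \<in> V" "V \<subseteq> U" "r \<in> ratpoly" "s \<in> ratpoly"
    "\<And>y. y \<in> V \<Longrightarrow> s y \<noteq> 0" "\<And>y. y \<in> V \<Longrightarrow> k y = r y / s y" using regular_funE[OF assms(2) x] by blast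
  show "\<exists>W p q. openin (zariski X) W \<and> x \<in> W \<and> W \<subseteq> U \<and> p \<in> ratpoly \<and> q \<in> ratpoly \<and>
        (\<forall>y\<in>W. q y \<noteq> 0 \<and> h y * k y = p y / q y)"
    using W V
    by (intro exI[of _ "W \<inter> V"] exI[of _ "\<lambda>y. p y * r y"] exI[of _ "\<lambda>y. q y * s y"])
       (auto intro!: ratpoly.mult)
qed

lemma regular_divide:
  assumes "regular_fun X U h" "regular_fun X U k" "\<And>x. x \<in> U \<Longrightarrow> k x \<noteq> 0"
  shows "regular_fun X U (\<lambda>x. h x / k x)"
proof (rule regular_funI)
  fix x assume x: "x \<in> U"
  obtain W p q where W: "openin (zariski X) W" "x \<in> W" "W \<subseteq> U" "p \<in> ratpoly" "q \<in> ratpoly"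
    "\<And>y. y \<in> W \<Longrightarrow> q y \<noteq> 0" "\<And>y. y \<in> W \<Longrightarrow> h y = p y / q y" using regular_funE[OF assms(1) x] by blast
  obtain V r s where V: "openin (zariski X) V" "x \<in> V" "V \<subseteq> U" "r \<in> ratpoly" "s \<in> ratpoly"
    "\<And>y. y \<in> V \<Longrightarrow> s y \<noteq> 0" "\<And>y. y \<in> V \<Longrightarrow> k y = r y / s y" using regular_funE[OF assms(2) x] by blast
  have "r y \<noteq> 0" if "y \<in> V" for y
    using V(3) V(7)[OF that] assms(3)[of y] that by auto
  then show "\<exists>W p q. openin (zariski X) W \<and> x \<in> W \<and> W \<subseteq> U \<and> p \<in> ratpoly \<and> q \<in> ratpoly \<and>
        (\<forall>y\<in>W. q y \<noteq> 0 \<and> h y / k y = p y / q y)"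
    using W V
    by (intro exI[of _ "W \<inter> V"] exI[of _ "\<lambda>y. p y * s y"] exI[of _ "\<lambda>y. q y * r y"])
       (auto intro!: ratpoly.mult)
qed

lemma regular_restrict:
  assumes "regular_fun X U h" "openin (zariski X) V" "V \<subseteq> U" shows "regular_fun X V h"
proof (rule regular_funI)
  fix x assume x: "x \<in> V"
  obtain W p q where W: "openin (zariski X) W" "x \<in> W" "W \<subseteq> U" "p \<in> ratpoly" "q \<in> ratpoly"
    "\<And>y. y \<in> W \<Longrightarrow> q y \<noteq> 0" "\<And>y. y \<in> W \<Longrightarrow> h y = p y / q y"
    using regular_funE[OF assms(1)] x assms(3) by blast
  then show "\<exists>W p q. openin (zariski X) W \<and> x \<in> W \<and> W \<subseteq> V \<and> p \<in> ratpoly \<and> q \<in> ratpoly \<and>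
        (\<forall>y\<in>W. q y \<noteq> 0 \<and> h y = p y / q y)"
    using x assms(2) by (intro exI[of _ "W \<inter> V"] exI[of _ p] exI[of _ q]) auto
qed

lemma regular_local:
  assumes "\<And>x. x \<in> U \<Longrightarrow> \<exists>V. openin (zariski X) V \<and> x \<in> V \<and> V \<subseteq> U \<and> regular_fun X V h"
  shows "regular_fun X U h"
proof (rule regular_funI)
  fix x assume "x \<in> U"
  then obtain V where V: "x \<in> V" "V \<subseteq> U" "regular_fun X V h" using assms by blast
  obtain W p q where "openin (zariski X) W" "x \<in> W" "W \<subseteq> V" "p \<in> ratpoly" "q \<in> ratpoly"
    "\<And>y. y \<in> W \<Longrightarrow> q y \<noteq> 0" "\<And>y. y \<in> W \<Longrightarrow> h y = p y / q y" using regular_funE[OF V(3,1)] by blast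
  with V(2) show "\<exists>W p q. openin (zariski X) W \<and> x \<in> W \<and> W \<subseteq> U \<and> p \<in> ratpoly \<and> q \<in> ratpoly \<and>
        (\<forall>y\<in>W. q y \<noteq> 0 \<and> h y = p y / q y)" by (intro exI[of _ W] exI[of _ p] exI[of _ q]) auto
qed

lemma regular_cong:
  assumes "regular_fun X U h" "\<And>x. x \<in> U \<Longrightarrow> h x = k x" shows "regular_fun X U k"
proof (rule regular_funI)
  fix x assume x: "x \<in> U"
  obtain W p q where W: "openin (zariski X) W" "x \<in> W" "W \<subseteq> U" "p \<in> ratpoly" "q \<in> ratpoly"
    "\<And>y. y \<in> W \<Longrightarrow> q y \<noteq> 0" "\<And>y. y \<in> W \<Longrightarrow> h y = p y / q y" using regular_funE[OF assms(1) x] by blast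
  have "k y = p y / q y" if "y \<in> W" for y
    using W(3) W(7)[OF that] assms(2)[of y] that by auto
  with W(1-6) show "\<exists>W p q. openin (zariski X) W \<and> x \<in> W \<and> W \<subseteq> U \<and> p \<in> ratpoly \<and> q \<in> ratpoly \<and>
        (\<forall>y\<in>W. q y \<noteq> 0 \<and> k y = p y / q y)"
    by (intro exI[of _ W] exI[of _ p] exI[of _ q]) auto
qed

lemma open_regular_nonzero:
  assumes "regular_fun X U h" shows "openin (zariski X) {x \<in> U. h x \<noteq> 0}"
proof (subst openin_subopen, intro ballI)
  fix x assume "x \<in> {x \<in> U. h x \<noteq> 0}"
  then have x: "x \<in> U" "h x \<noteq> 0" by auto
  obtain W p q where W: "openin (zariski X) W" "x \<in> W" "W \<subseteq> U" "p \<in> ratpoly" "q \<in> ratpoly"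
    "\<And>y. y \<in> W \<Longrightarrow> q y \<noteq> 0" "\<And>y. y \<in> W \<Longrightarrow> h y = p y / q y" using regular_funE[OF assms x(1)] by blast
  have "openin (zariski X) (W \<inter> {y \<in> X. p y \<noteq> 0})" by (rule openin_Int[OF W(1) open_nonzero[OF W(4)]])
  moreover have "x \<in> W \<inter> {y \<in> X. p y \<noteq> 0}" using W(2) W(7)[OF W(2)] x open_subset_X[OF W(1)] by auto
  moreover have "W \<inter> {y \<in> X. p y \<noteq> 0} \<subseteq> {x \<in> U. h x \<noteq> 0}" using W(3,6,7) by auto
  ultimately show "\<exists>T. openin (zariski X) T \<and> x \<in> T \<and> T \<subseteq> {x \<in> U. h x \<noteq> 0}"
    by (intro exI conjI)
qed

lemma rat_repD:
  assumes "rat_rep X f"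
  shows "dense_open X (dom f)" "openin (zariski X) (dom f)" "ran f \<subseteq> X"
    "u \<in> coords \<Longrightarrow> regular_fun X (dom f) (\<lambda>x. u (the (f x)))"
  using assms unfolding rat_rep_def dense_open_def by blast+

lemma rat_rep_ran: "rat_rep X f \<Longrightarrow> x \<in> dom f \<Longrightarrow> the (f x) \<in> X"
  using rat_repD(3) by (metis domD option.sel ranI subsetD)

lemma regular_pullback_poly:
  assumes "p \<in> ratpoly" "rat_rep X f" shows "regular_fun X (dom f) (\<lambda>x. p (the (f x)))"
  using assms(1)
  by induction (auto intro: regular_add regular_mult rat_repD[OF assms(2)] regular_ratpoly ratpoly.const)

lemma open_preimage:
  assumes f: "rat_rep X f" and W: "openin (zariski X) W"
  shows "openin (zariski X) {x \<in> dom f. the (f x) \<in> W}"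
proof -
  obtain P where P: "P \<subseteq> ratpoly" "W = {x \<in> X. \<exists>p\<in>P. p x \<noteq> 0}" using W unfolding openin_zariski by blast
  have "{x \<in> dom f. the (f x) \<in> W} = (\<Union>p\<in>P. {x \<in> dom f. p (the (f x)) \<noteq> 0})"
    using rat_rep_ran[OF f] unfolding P(2) by blast
  moreover have "openin (zariski X) {x \<in> dom f. p (the (f x)) \<noteq> 0}" if "p \<in> P" for p
    by (rule open_regular_nonzero[OF regular_pullback_poly[OF subsetD[OF P(1) that] f]])
  ultimately show ?thesis by (auto intro!: openin_Union)
qed

lemma dom_map_comp: "dom (f \<circ>\<^sub>m g) = {x \<in> dom g. the (g x) \<in> dom f}"
  by (auto simp: map_comp_def split: option.splits)

lemma map_comp_rep:
  assumes f: "rat_rep X f" and g: "rat_rep X g" and D: "dense_open X W" "W \<subseteq> dom (f \<circ>\<^sub>m g)"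
  shows "rat_rep X (f \<circ>\<^sub>m g)"
proof -
  have op: "openin (zariski X) (dom (f \<circ>\<^sub>m g))"
    unfolding dom_map_comp by (rule open_preimage[OF g rat_repD(2)[OF f]])
  have "ran (f \<circ>\<^sub>m g) \<subseteq> ran f"
    unfolding ran_def map_comp_def by (auto simp del: split_paired_Ex split: option.splits)
  then have "ran (f \<circ>\<^sub>m g) \<subseteq> X" using rat_repD(3)[OF f] by blast
  moreover have "regular_fun X (dom (f \<circ>\<^sub>m g)) (\<lambda>x. u (the ((f \<circ>\<^sub>m g) x)))" if u: "u \<in> coords" for u
  proof (rule regular_local)
    fix x assume x: "x \<in> dom (f \<circ>\<^sub>m g)"
    then have "the (g x) \<in> dom f" by (simp add: dom_map_comp)
    then obtain W p q where W: "openin (zariski X) W" "the (g x) \<in> W" "W \<subseteq> dom f" "p \<in> ratpoly"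
      "q \<in> ratpoly" "\<And>y. y \<in> W \<Longrightarrow> q y \<noteq> 0" "\<And>y. y \<in> W \<Longrightarrow> u (the (f y)) = p y / q y"
      using regular_funE[OF rat_repD(4)[OF f u]] by blast
    let ?V = "{x \<in> dom g. the (g x) \<in> W}"
    have V: "openin (zariski X) ?V" by (rule open_preimage[OF g W(1)])
    have "regular_fun X ?V (\<lambda>x. p (the (g x)) / q (the (g x)))"
      using W by (intro regular_divide regular_restrict[OF regular_pullback_poly[OF _ g] V]) auto
    then have "regular_fun X ?V (\<lambda>x. u (the ((f \<circ>\<^sub>m g) x)))"
      by (rule regular_cong) (use W in auto)
    then show "\<exists>V. openin (zariski X) V \<and> x \<in> V \<and> V \<subseteq> dom (f \<circ>\<^sub>m g) \<and>
        regular_fun X V (\<lambda>x. u (the ((f \<circ>\<^sub>m g) x)))"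
      using V W x by (intro exI[of _ ?V]) (auto simp: dom_map_comp)
  qed
  ultimately show ?thesis using dense_open_mono[OF D(1) op D(2)] unfolding rat_rep_def by blast
qed

lemma rat_eqI:
  assumes "rat_rep X f" "rat_rep X g" "dense_open X W" "\<And>x. x \<in> W \<Longrightarrow> x \<in> dom f"
    "\<And>x. x \<in> W \<Longrightarrow> f x = g x"
  shows "(f, g) \<in> rat_eq X"
proof -
  have "W \<subseteq> dom f \<inter> dom g" using assms(4,5) by fastforce
  then show ?thesis using assms unfolding rat_eq_def by blast
qed

lemma rat_eqE:
  assumes "(f, g) \<in> rat_eq X"
  obtains W where "rat_rep X f" "rat_rep X g" "dense_open X W" "W \<subseteq> dom f" "W \<subseteq> dom g"
    "\<And>x. x \<in> W \<Longrightarrow> f x = g x"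
  using assms unfolding rat_eq_def by auto

lemma rat_eq_equiv: "equiv (Collect (rat_rep X)) (rat_eq X)"
proof (rule equivI)
  show "rat_eq X \<subseteq> Collect (rat_rep X) \<times> Collect (rat_rep X)" by (auto simp: rat_eq_def)
  show "refl_on (Collect (rat_rep X)) (rat_eq X)"
    by (rule refl_onI) (auto intro: rat_eqI rat_repD(1))
  show "sym (rat_eq X)"
  proof (rule symI)
    fix f g assume "(f, g) \<in> rat_eq X"
    then obtain W where "rat_rep X f" "rat_rep X g" "dense_open X W" "W \<subseteq> dom g"
      "\<And>x. x \<in> W \<Longrightarrow> f x = g x" by (elim rat_eqE) blast
    then show "(g, f) \<in> rat_eq X" by (intro rat_eqI[of X g f W]) auto
  qed
  show "trans (rat_eq X)"
  proof (rule transI)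
    fix f g h assume "(f, g) \<in> rat_eq X" "(g, h) \<in> rat_eq X"
    then obtain W V where "rat_rep X f" "rat_rep X h" "dense_open X W" "W \<subseteq> dom f" "dense_open X V"
      "\<And>x. x \<in> W \<Longrightarrow> f x = g x" "\<And>x. x \<in> V \<Longrightarrow> g x = h x"
      by (elim rat_eqE) blast
    then show "(f, h) \<in> rat_eq X" using dense_open_Int by (intro rat_eqI[of X f h "W \<inter> V"]) auto
  qed
qed

lemma rat_class_eq_iff:
  "rat_rep X f \<Longrightarrow> rat_rep X g \<Longrightarrow> rat_class X f = rat_class X g \<longleftrightarrow> (f, g) \<in> rat_eq X"
  unfolding rat_class_def using eq_equiv_class_iff[OF rat_eq_equiv] by simp

lemma rat_class_self: "rat_rep X f \<Longrightarrow> f \<in> rat_class X f"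
  unfolding rat_class_def using equiv_class_self[OF rat_eq_equiv] by simp

lemma in_rat_class: "g \<in> rat_class X f \<longleftrightarrow> (f, g) \<in> rat_eq X"
  by (simp add: rat_class_def)

lemma rational_maps_iff: "F \<in> rational_maps X \<longleftrightarrow> (\<exists>f. rat_rep X f \<and> F = rat_class X f)"
  unfolding rational_maps_def rat_class_def quotient_def by auto

lemma Some_rep: "rat_rep X (Some |` X)"
proof -
  have "regular_fun X X (\<lambda>x. u (the ((Some |` X) x)))" if "u \<in> coords" for u
    by (rule regular_cong[OF regular_ratpoly[OF _ ratpoly.coord[OF that]]])
       (use dense_open_X in \<open>auto simp: dense_open_def\<close>)
  moreover have "dom (Some |` X) = X" "ran (Some |` X) = X"
    by (auto simp: ran_def restrict_map_def split: if_splits simp del: split_paired_Ex)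
  ultimately show ?thesis unfolding rat_rep_def using dense_open_X by auto
qed

definition rat_inverse :: "pt set \<Rightarrow> (pt \<rightharpoonup> pt) \<Rightarrow> (pt \<rightharpoonup> pt) \<Rightarrow> bool" where
  "rat_inverse X f g \<longleftrightarrow> rat_rep X f \<and> rat_rep X g \<and>
     (\<exists>W. dense_open X W \<and> (\<forall>x\<in>W. (f \<circ>\<^sub>m g) x = Some x \<and> (g \<circ>\<^sub>m f) x = Some x))"

lemma rat_inverse_sym: "rat_inverse X f g \<Longrightarrow> rat_inverse X g f"
  unfolding rat_inverse_def by blast

lemma dense_preimage:
  assumes "rat_inverse X f g" and D: "dense_open X D"
  shows "dense_open X {x \<in> dom f. the (f x) \<in> D}"
proof -
  from assms(1) obtain W where f: "rat_rep X f" and g: "rat_rep X g" and W: "dense_open X W"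
    and inv: "\<And>x. x \<in> W \<Longrightarrow> (f \<circ>\<^sub>m g) x = Some x" "\<And>x. x \<in> W \<Longrightarrow> (g \<circ>\<^sub>m f) x = Some x"
    unfolding rat_inverse_def by blast
  have "{x \<in> dom f. the (f x) \<in> D} \<inter> T \<noteq> {}" if T: "openin (zariski X) T" "T \<noteq> {}" for T
  proof -
    have TW: "openin (zariski X) (T \<inter> W)" "T \<inter> W \<noteq> {}"
      using T W unfolding dense_open_iff by auto
    then obtain x where x: "x \<in> T" "x \<in> W" by blast
    obtain y where "f x = Some y" "g y = Some x"
      using inv(2)[OF x(2)] by (auto simp: map_comp_Some_iff)
    then have "y \<in> {y \<in> dom g. the (g y) \<in> T \<inter> W}" using x by (simp add: domIff del: split_paired_Ex)
    then have "{y \<in> dom g. the (g y) \<in> T \<inter> W} \<noteq> {}" by blast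
    then have "D \<inter> W \<inter> {y \<in> dom g. the (g y) \<in> T \<inter> W} \<noteq> {}"
      using dense_open_Int[OF D W] open_preimage[OF g TW(1)] unfolding dense_open_iff by blast
    then obtain z where z: "z \<in> D" "z \<in> W" "z \<in> dom g" "the (g z) \<in> T" by blast
    then have "f (the (g z)) = Some z" using inv(1)[OF z(2)] by (auto simp: map_comp_Some_iff)
    with z show ?thesis by force
  qed
  moreover have "openin (zariski X) {x \<in> dom f. the (f x) \<in> D}"
    using open_preimage[OF f] D unfolding dense_open_def by blast
  ultimately show ?thesis unfolding dense_open_iff by blast
qed

lemma rat_inverse_cong:
  assumes "rat_inverse X f g" and ff: "(f, f') \<in> rat_eq X" shows "rat_inverse X f' g"
proof -
  from assms(1) obtain W where g: "rat_rep X g" and W: "dense_open X W"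
    and inv: "\<And>x. x \<in> W \<Longrightarrow> (f \<circ>\<^sub>m g) x = Some x" "\<And>x. x \<in> W \<Longrightarrow> (g \<circ>\<^sub>m f) x = Some x"
    unfolding rat_inverse_def by blast
  obtain V where f': "rat_rep X f'" and V: "dense_open X V" and e: "\<And>x. x \<in> V \<Longrightarrow> f x = f' x"
    using ff by (elim rat_eqE) blast
  let ?U = "W \<inter> V \<inter> {x \<in> dom g. the (g x) \<in> V}"
  have "dense_open X ?U"
    using dense_preimage[OF rat_inverse_sym[OF assms(1)] V] W V by (intro dense_open_Int)
  moreover have "(f' \<circ>\<^sub>m g) x = Some x \<and> (g \<circ>\<^sub>m f') x = Some x" if "x \<in> ?U" for x
    using that inv[of x] e[of x] e[of "the (g x)"] by (auto simp: map_comp_def)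
  ultimately show ?thesis unfolding rat_inverse_def using f' g by blast
qed

lemma comp_rep:
  assumes f: "rat_rep X f" and g: "rat_inverse X g g'" shows "rat_rep X (f \<circ>\<^sub>m g)"
proof (rule map_comp_rep[OF f])
  show "rat_rep X g" using g by (simp add: rat_inverse_def)
  show "dense_open X {x \<in> dom g. the (g x) \<in> dom f}" by (rule dense_preimage[OF g rat_repD(1)[OF f]])
qed (simp add: dom_map_comp)

lemma comp_cong:
  assumes g: "rat_inverse X g g'" and ff: "(f, f1) \<in> rat_eq X" and gg: "(g, g1) \<in> rat_eq X"
  shows "(f \<circ>\<^sub>m g, f1 \<circ>\<^sub>m g1) \<in> rat_eq X"
proof -
  obtain W where W: "rat_rep X f" "rat_rep X f1" "dense_open X W" "W \<subseteq> dom f" "\<And>x. x \<in> W \<Longrightarrow> f x = f1 x"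
    using ff by (elim rat_eqE) blast
  obtain V where V: "dense_open X V" "V \<subseteq> dom g" "\<And>x. x \<in> V \<Longrightarrow> g x = g1 x"
    using gg by (elim rat_eqE) blast
  show ?thesis
  proof (rule rat_eqI)
    show "rat_rep X (f \<circ>\<^sub>m g)" by (rule comp_rep[OF W(1) g])
    show "rat_rep X (f1 \<circ>\<^sub>m g1)" by (rule comp_rep[OF W(2) rat_inverse_cong[OF g gg]])
    show "dense_open X ({x \<in> dom g. the (g x) \<in> W} \<inter> V)"
      using dense_preimage[OF g W(3)] V(1) by (rule dense_open_Int)
    fix x assume x: "x \<in> {x \<in> dom g. the (g x) \<in> W} \<inter> V"
    then show "x \<in> dom (f \<circ>\<^sub>m g)" using W(4) by (auto simp: dom_map_comp)
    have "g1 x = g x" using V(3) x by simp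
    then show "(f \<circ>\<^sub>m g) x = (f1 \<circ>\<^sub>m g1) x" using x W(5) by (auto simp: map_comp_def)
  qed
qed

lemma rat_comp_class:
  assumes f: "rat_rep X f" and g: "rat_inverse X g g'"
  shows "rat_comp X (rat_class X f) (rat_class X g) = rat_class X (f \<circ>\<^sub>m g)"
proof -
  have "rat_rep X g" using g by (simp add: rat_inverse_def)
  have "rat_class X (f1 \<circ>\<^sub>m g1) = rat_class X (f \<circ>\<^sub>m g)"
    if "f1 \<in> rat_class X f" "g1 \<in> rat_class X g" for f1 g1
  proof -
    have "(f \<circ>\<^sub>m g, f1 \<circ>\<^sub>m g1) \<in> rat_eq X" using that comp_cong[OF g] by (simp add: in_rat_class)
    then show ?thesis using equiv_class_eq[OF rat_eq_equiv] unfolding rat_class_def by blast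
  qed
  then show ?thesis
    unfolding rat_comp_def using rat_class_self[OF f] rat_class_self[OF \<open>rat_rep X g\<close>] by blast
qed

lemma comp_id_imp:
  assumes "rat_comp X (rat_class X f) (rat_class X g) = rat_id X"
  obtains f1 g1 where "(f, f1) \<in> rat_eq X" "(g, g1) \<in> rat_eq X" "(f1 \<circ>\<^sub>m g1, Some |` X) \<in> rat_eq X"
proof -
  have "Some |` X \<in> rat_id X" unfolding rat_id_def by (rule rat_class_self[OF Some_rep])
  then have "Some |` X \<in> rat_comp X (rat_class X f) (rat_class X g)" using assms by simp
  then show thesis using that unfolding rat_comp_def by (auto simp: in_rat_class)
qed

lemma rat_eq_SomeE:
  assumes "(h, Some |` X) \<in> rat_eq X"
  obtains W where "dense_open X W" "\<And>x. x \<in> W \<Longrightarrow> h x = Some x"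
proof -
  obtain W where "dense_open X W" "W \<subseteq> dom (Some |` X)" "\<And>x. x \<in> W \<Longrightarrow> h x = (Some |` X) x"
    using assms by (elim rat_eqE) blast
  then show thesis by (intro that) auto
qed

lemma rat_inverse_comp_id:
  assumes "rat_inverse X f g" shows "rat_comp X (rat_class X f) (rat_class X g) = rat_id X"
proof -
  from assms obtain W where f: "rat_rep X f" and g: "rat_rep X g" and W: "dense_open X W"
    and inv: "\<And>x. x \<in> W \<Longrightarrow> (f \<circ>\<^sub>m g) x = Some x"
    unfolding rat_inverse_def by blast
  have "W \<subseteq> X" using W open_subset_X unfolding dense_open_def by blast
  have r: "rat_rep X (f \<circ>\<^sub>m g)" by (rule comp_rep[OF f rat_inverse_sym[OF assms]])
  have "(f \<circ>\<^sub>m g, Some |` X) \<in> rat_eq X"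
    using inv \<open>W \<subseteq> X\<close> by (intro rat_eqI[OF r Some_rep W]) auto
  then show ?thesis
    using rat_comp_class[OF f rat_inverse_sym[OF assms]] rat_class_eq_iff[OF r Some_rep]
    by (simp add: rat_id_def)
qed

lemma rat_inverse_id: "rat_inverse X (Some |` X) (Some |` X)"
  unfolding rat_inverse_def
  using Some_rep dense_open_X by (auto intro!: exI[of _ X] simp: map_comp_def)

lemma rat_inverse_comp:
  assumes f: "rat_inverse X f f'" and g: "rat_inverse X g g'"
  shows "rat_inverse X (f \<circ>\<^sub>m g) (g' \<circ>\<^sub>m f')"
proof -
  from f obtain W where rf: "rat_rep X f" "rat_rep X f'" and W: "dense_open X W"
    and invf: "\<And>x. x \<in> W \<Longrightarrow> (f \<circ>\<^sub>m f') x = Some x \<and> (f' \<circ>\<^sub>m f) x = Some x"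
    unfolding rat_inverse_def by blast
  from g obtain V where rg: "rat_rep X g" "rat_rep X g'" and V: "dense_open X V"
    and invg: "\<And>x. x \<in> V \<Longrightarrow> (g \<circ>\<^sub>m g') x = Some x \<and> (g' \<circ>\<^sub>m g) x = Some x"
    unfolding rat_inverse_def by blast
  let ?U = "W \<inter> {x \<in> dom f'. the (f' x) \<in> V} \<inter> (V \<inter> {x \<in> dom g. the (g x) \<in> W})"
  have "dense_open X ?U"
    using dense_preimage[OF rat_inverse_sym[OF f] V] dense_preimage[OF g W] V W
    by (intro dense_open_Int)
  moreover have "((f \<circ>\<^sub>m g) \<circ>\<^sub>m (g' \<circ>\<^sub>m f')) x = Some x \<and> ((g' \<circ>\<^sub>m f') \<circ>\<^sub>m (f \<circ>\<^sub>m g)) x = Some x"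
    if x: "x \<in> ?U" for x
  proof -
    obtain y z where y: "f' x = Some y" "y \<in> V" and z: "g x = Some z" "z \<in> W" using x by auto
    have "f y = Some x" "g' z = Some x"
      using invf[of x] invg[of x] x y z by (auto simp: map_comp_Some_iff)
    moreover have "(g \<circ>\<^sub>m g') y = Some y" "(f' \<circ>\<^sub>m f) z = Some z" using invf invg y z by auto
    ultimately show ?thesis using y z by (auto simp: map_comp_def split: option.splits)
  qed
  ultimately show ?thesis
    unfolding rat_inverse_def
    using comp_rep[OF rf(1) g] comp_rep[OF rg(2) rat_inverse_sym[OF f]] by blast
qed

lemma birational_iff:
  "birational X F \<longleftrightarrow> (\<exists>f g. rat_inverse X f g \<and> F = rat_class X f)"
proof
  assume "birational X F"
  then obtain G where "F \<in> rational_maps X" "G \<in> rational_maps X"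
    and FG: "rat_comp X F G = rat_id X" "rat_comp X G F = rat_id X"
    unfolding birational_def by blast
  then obtain f g where F: "F = rat_class X f" and G: "G = rat_class X g"
    unfolding rational_maps_iff by metis
  note c = FG[unfolded F G]
  obtain f1 g1 where 1: "(f, f1) \<in> rat_eq X" "(g, g1) \<in> rat_eq X" "(f1 \<circ>\<^sub>m g1, Some |` X) \<in> rat_eq X"
    by (rule comp_id_imp[OF c(1)])
  obtain g2 f2 where 2: "(g, g2) \<in> rat_eq X" "(f, f2) \<in> rat_eq X" "(g2 \<circ>\<^sub>m f2, Some |` X) \<in> rat_eq X"
    by (rule comp_id_imp[OF c(2)])
  obtain A where A: "dense_open X A" "\<And>x. x \<in> A \<Longrightarrow> (f1 \<circ>\<^sub>m g1) x = Some x"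
    using rat_eq_SomeE[OF 1(3)] by blast
  obtain B where B: "dense_open X B" "\<And>x. x \<in> B \<Longrightarrow> (g2 \<circ>\<^sub>m f2) x = Some x"
    using rat_eq_SomeE[OF 2(3)] by blast
  have *: "(h1, h2) \<in> rat_eq X" if "(h, h1) \<in> rat_eq X" "(h, h2) \<in> rat_eq X" for h h1 h2
    using that rat_eq_equiv[of X] by (meson equivE symD transD)
  obtain V where r: "rat_rep X f1" "rat_rep X f2" and V: "dense_open X V"
    "\<And>x. x \<in> V \<Longrightarrow> f1 x = f2 x"
    using *[OF 1(1) 2(2)] by (elim rat_eqE) blast
  obtain V' where r': "rat_rep X g1" "rat_rep X g2" and V': "dense_open X V'"
    "\<And>x. x \<in> V' \<Longrightarrow> g1 x = g2 x"
    using *[OF 1(2) 2(1)] by (elim rat_eqE) blast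
  let ?E = "{x \<in> dom f1. the (f1 x) \<in> V'}"
  have "?E \<inter> T \<noteq> {}" if T: "openin (zariski X) T" "T \<noteq> {}" for T
  proof -
    let ?T = "T \<inter> (B \<inter> V)"
    have TB: "openin (zariski X) ?T" "?T \<noteq> {}"
      using T dense_open_Int[OF B(1) V(1)] unfolding dense_open_iff by auto
    then obtain x where x: "x \<in> ?T" by blast
    obtain y where "f2 x = Some y" "g2 y = Some x"
      using B(2)[of x] x by (auto simp: map_comp_Some_iff)
    then have "y \<in> {y \<in> dom g2. the (g2 y) \<in> ?T}" using x by (simp add: domIff del: split_paired_Ex)
    then have "{y \<in> dom g2. the (g2 y) \<in> ?T} \<noteq> {}" by blast
    then have "A \<inter> V' \<inter> {y \<in> dom g2. the (g2 y) \<in> ?T} \<noteq> {}"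
      using dense_open_Int[OF A(1) V'(1)] open_preimage[OF r'(2) TB(1)]
      unfolding dense_open_iff by blast
    then obtain z where z: "z \<in> A" "z \<in> V'" "z \<in> dom g2" "the (g2 z) \<in> T" by blast
    then have "f1 (the (g2 z)) = Some z"
      using A(2)[OF z(1)] V'(2)[OF z(2)] by (auto simp: map_comp_Some_iff)
    with z show ?thesis by force
  qed
  moreover have "openin (zariski X) ?E"
    using open_preimage[OF r(1)] V'(1) unfolding dense_open_def by blast
  ultimately have E: "dense_open X ?E" unfolding dense_open_iff by blast
  have "dense_open X (A \<inter> (?E \<inter> (B \<inter> V)))"
    using A(1) B(1) V(1) E by (intro dense_open_Int)
  moreover have "(f1 \<circ>\<^sub>m g1) x = Some x \<and> (g1 \<circ>\<^sub>m f1) x = Some x" if x: "x \<in> A \<inter> (?E \<inter> (B \<inter> V))" for x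
  proof -
    obtain y where y: "f2 x = Some y" "g2 y = Some x"
      using B(2)[of x] x by (auto simp: map_comp_Some_iff)
    then have "f1 x = Some y" using V(2)[of x] x by simp
    then have "y \<in> V'" using x by auto
    then have "g1 y = Some x" using V'(2) y by simp
    then show ?thesis using A(2)[of x] x \<open>f1 x = Some y\<close> by (simp add: map_comp_Some_iff)
  qed
  ultimately have "rat_inverse X f1 g1" unfolding rat_inverse_def using r r' by blast
  moreover have "F = rat_class X f1"
    unfolding F rat_class_def using equiv_class_eq[OF rat_eq_equiv 1(1)] .
  ultimately show "\<exists>f g. rat_inverse X f g \<and> F = rat_class X f" by blast
next
  assume "\<exists>f g. rat_inverse X f g \<and> F = rat_class X f"
  then obtain f g where i: "rat_inverse X f g" and F: "F = rat_class X f" by blast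
  then have r: "rat_rep X f" "rat_rep X g" by (auto simp: rat_inverse_def)
  have "rat_class X f \<in> rational_maps X" "rat_class X g \<in> rational_maps X"
    using r by (auto simp: rational_maps_iff simp del: split_paired_Ex)
  then show "birational X F"
    unfolding birational_def F
    using rat_inverse_comp_id[OF i] rat_inverse_comp_id[OF rat_inverse_sym[OF i]]
    by (intro conjI bexI[of _ "rat_class X g"])
qed

lemma group_Bir: "group (Bir X)"
proof (rule groupI)
  fix F G assume "F \<in> carrier (Bir X)" "G \<in> carrier (Bir X)"
  then obtain f f' g g' where f: "rat_inverse X f f'" "F = rat_class X f"
    and g: "rat_inverse X g g'" "G = rat_class X g"
    by (auto simp: Bir_def birational_iff)
  have "rat_inverse X (f \<circ>\<^sub>m g) (g' \<circ>\<^sub>m f')" by (rule rat_inverse_comp[OF f(1) g(1)])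
  moreover have "F \<otimes>\<^bsub>Bir X\<^esub> G = rat_class X (f \<circ>\<^sub>m g)"
    using rat_comp_class[OF _ g(1)] f g(2) by (simp add: Bir_def rat_inverse_def)
  ultimately show "F \<otimes>\<^bsub>Bir X\<^esub> G \<in> carrier (Bir X)" by (auto simp: Bir_def birational_iff)
next
  show "\<one>\<^bsub>Bir X\<^esub> \<in> carrier (Bir X)"
    using rat_inverse_id by (auto simp: Bir_def birational_iff rat_id_def)
next
  fix F G H assume "F \<in> carrier (Bir X)" "G \<in> carrier (Bir X)" "H \<in> carrier (Bir X)"
  then obtain f f' g g' h h' where f: "rat_inverse X f f'" "F = rat_class X f"
    and g: "rat_inverse X g g'" "G = rat_class X g"
    and h: "rat_inverse X h h'" "H = rat_class X h"
    by (auto simp: Bir_def birational_iff)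
  have r: "rat_rep X f" "rat_rep X (f \<circ>\<^sub>m g)"
    using f(1) comp_rep[OF _ g(1)] by (auto simp: rat_inverse_def)
  have "rat_comp X (rat_comp X F G) H = rat_class X ((f \<circ>\<^sub>m g) \<circ>\<^sub>m h)"
    unfolding f(2) g(2) h(2) rat_comp_class[OF r(1) g(1)] by (rule rat_comp_class[OF r(2) h(1)])
  also have "(f \<circ>\<^sub>m g) \<circ>\<^sub>m h = f \<circ>\<^sub>m (g \<circ>\<^sub>m h)"
    by (rule ext) (simp add: map_comp_def split: option.splits)
  also have "rat_class X (f \<circ>\<^sub>m (g \<circ>\<^sub>m h)) = rat_comp X F (rat_comp X G H)"
    unfolding f(2) g(2) h(2)
    using g(1) by (simp add: rat_comp_class[OF _ h(1)] rat_inverse_def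
        rat_comp_class[OF r(1) rat_inverse_comp[OF g(1) h(1)]])
  finally show "F \<otimes>\<^bsub>Bir X\<^esub> G \<otimes>\<^bsub>Bir X\<^esub> H = F \<otimes>\<^bsub>Bir X\<^esub> (G \<otimes>\<^bsub>Bir X\<^esub> H)" by (simp add: Bir_def)
next
  fix F assume "F \<in> carrier (Bir X)"
  then obtain f f' where f: "rat_inverse X f f'" "F = rat_class X f"
    by (auto simp: Bir_def birational_iff)
  have "rat_comp X (rat_id X) F = rat_class X ((Some |` X) \<circ>\<^sub>m f)"
    unfolding rat_id_def f(2) by (rule rat_comp_class[OF Some_rep f(1)])
  also have "(Some |` X) \<circ>\<^sub>m f = f"
  proof
    have "rat_rep X f" using f(1) by (simp add: rat_inverse_def)
    fix x show "((Some |` X) \<circ>\<^sub>m f) x = f x"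
    proof (cases "f x")
      case (Some y)
      then have "y \<in> X" using rat_rep_ran[OF \<open>rat_rep X f\<close>, of x] by (simp add: domIff)
      with Some show ?thesis by (simp add: map_comp_def)
    qed (simp add: map_comp_def)
  qed
  finally show "\<one>\<^bsub>Bir X\<^esub> \<otimes>\<^bsub>Bir X\<^esub> F = F" by (simp add: Bir_def f(2))
  have "birational X (rat_class X f')" using rat_inverse_sym[OF f(1)] birational_iff by blast
  then show "\<exists>G\<in>carrier (Bir X). G \<otimes>\<^bsub>Bir X\<^esub> F = \<one>\<^bsub>Bir X\<^esub>"
    using rat_inverse_comp_id[OF rat_inverse_sym[OF f(1)]] f(2) by (auto simp: Bir_def)
qed

section \<open>The surface and its birational maps\<close>

definition X4 :: "pt set" where
  "X4 = {(x1, x2, x3, x4). x4^2 - 2*x3^2 + x2^2 = 2 \<and> x3^2 - 2*x2^2 + x1^2 = 2}"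

definition tau :: "pt \<rightharpoonup> pt" where
  "tau = (\<lambda>(a, b, c, d). Some (d, c, b, a)) |` X4"

definition mu14 :: "pt \<rightharpoonup> pt" where
  "mu14 = (\<lambda>(a, b, c, d). Some (- a, b, c, - d)) |` X4"

definition phi_q :: "pt \<Rightarrow> complex" where
  "phi_q = (\<lambda>(a, b, c, d). (b - c)^2 * (a - 2*b + c))"

definition phi_p1 :: "pt \<Rightarrow> complex" where
  "phi_p1 = (\<lambda>(a, b, c, d).
     - 2*a*b^3 + a*b^2*c + 2*a*b^2*d + 4*a*b*c^2 - 5*a*b*c*d + a*b - 2*a*c^3 + 2*a*c^2*d
     + a*c - a*d + 3*b^4 - 2*b^3*c - 3*b^3*d - 6*b^2*c^2 + 8*b^2*c*d + b^2 + 4*b*c^3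
     - 4*b*c^2*d - 5*b*c + b*d + c^2 + c*d - 2)"

definition phi_p2 :: "pt \<Rightarrow> complex" where
  "phi_p2 = (\<lambda>(a, b, c, d).
     - 2*a*b^2*c + 5*a*b*c^2 - 2*a*b*c*d + 2*a*b - 2*a*c^3 + a*c^2*d - a*d + 3*b^3*c
     - 8*b^2*c^2 + 3*b^2*c*d - 2*b^2 + 4*b*c^3 - 2*b*c^2*d - b*c + 2*b*d - 2)"

definition phi_p3 :: "pt \<Rightarrow> complex" where
  "phi_p3 = (\<lambda>(a, b, c, d).
     - 2*a*b^3 + 5*a*b^2*c - 2*a*b^2*d - 2*a*b*c^2 + a*b*c*d + 3*a*b - a*c - a*d + 3*b^4
     - 8*b^3*c + 3*b^3*d + 4*b^2*c^2 - 2*b^2*c*d - 3*b^2 - b*c + 3*b*d + c^2 - c*d - 2)"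

definition phi_p4 :: "pt \<Rightarrow> complex" where
  "phi_p4 = (\<lambda>(a, b, c, d).
     - 3*a*b^3 + 8*a*b^2*c - 3*a*b^2*d - 4*a*b*c^2 + 2*a*b*c*d + 4*a*b - 2*a*c - a*d
     + 4*b^4 - 10*b^3*c + 4*b^3*d + 2*b^2*c^2 - 2*b^2*c*d - 4*b^2 + 5*b*c^3 - 2*b*c^2*d
     - b*c + 4*b*d - 2*c^4 + c^3*d + 2*c^2 - 2*c*d - 2)"

definition phi :: "pt \<rightharpoonup> pt" where
  "phi = (\<lambda>x. Some (phi_p1 x / phi_q x, phi_p2 x / phi_q x, phi_p3 x / phi_q x, phi_p4 x / phi_q x))
     |` {x \<in> X4. phi_q x \<noteq> 0}"

definition zeta :: "(pt \<rightharpoonup> pt) set" where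
  "zeta = rat_class X4 phi \<otimes>\<^bsub>Bir X4\<^esub> rat_class X4 tau \<otimes>\<^bsub>Bir X4\<^esub> rat_class X4 mu14"

end

theory Submission
  imports Defs
begin

text \<open>
  Put \<open>e = a - 2b + c\<close>, \<open>g = b - 2c + d\<close> and \<open>y = c - b\<close>. The map \<open>(e, g)\<close> has degree two on
  \<open>X4\<close>: eliminating \<open>b\<close> from the equations of the surface leaves
  \<open>(g - e)(2y^2 - eg - 2) = 6egy\<close>, a quadratic equation for \<open>y\<close> whose roots have product
  \<open>-(eg + 2)/2\<close>. The map \<open>phi\<close> exchanges the two roots, so it is a birational involution.
  The line of points \<open>(-x, x + 1, x + 2, x + 3)\<close> lies on \<open>X4\<close>, and \<open>zeta\<close> acts on it as the
  translation \<open>x \<mapsto> x + 3\<close>. The orbit of \<open>(0, 1, 2, 3)\<close> never leaves the domain of definition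
  and is infinite, whereas a power of \<open>zeta\<close> equal to the identity on a dense open set would
  fix every point of its domain.
\<close>

section \<open>The involution \<open>phi\<close> in fibre coordinates\<close>

text \<open>Modulo the equations of \<open>X4\<close> the numerators depend only on
  \<open>e\<close>, \<open>g\<close> and \<open>y\<close>. With \<open>e*g + 2 = - 2*y*z\<close>,
  where \<open>z\<close> is the second root, each right-hand side is divisible by
  \<open>y^2 * e\<close>, the value of \<open>phi_q\<close>.\<close>

lemma phi_p_diff:
  fixes a b c d :: complex
  assumes X: "(a, b, c, d) \<in> X4"
  defines "e \<equiv> a - 2*b + c" and "g \<equiv> b - 2*c + d" and "y \<equiv> c - b"
  shows "4 * phi_p2 (a,b,c,d) = 4*y^2 - (e*g+2)^2 - 2*e^2*y^2 - 2*e*y*(e*g+2)" (is "?L2 = ?R2")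
    and "2 * (phi_p1 (a,b,c,d) - phi_p2 (a,b,c,d)) = e*y*(e*g+2) + 2*e^2*y^2" (is "?L1 = ?R1")
    and "2 * (phi_p3 (a,b,c,d) - phi_p2 (a,b,c,d)) = - e*y*(e*g+2)" (is "?L3 = ?R3")
    and "phi_p4 (a,b,c,d) - phi_p2 (a,b,c,d) = e*g*y^2 - e*y*(e*g+2)" (is "?L4 = ?R4")
proof -
  have E: "d^2 - 2*c^2 + b^2 - 2 = 0" "c^2 - 2*b^2 + a^2 - 2 = 0"
    using X by (auto simp: X4_def)
  \<comment> \<open>The explicit cofactors of the two defining polynomials certify that the
    difference lies in the ideal of \<open>X4\<close>; likewise below.\<close>
  have "?L2 - ?R2 = (a - 2*b + c)^2 * (d^2 - 2*c^2 + b^2 - 2)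
      + (4*c^2 - 2*b*c - 2*c*d + 2) * (c^2 - 2*b^2 + a^2 - 2)"
    unfolding phi_p2_def prod.case e_def g_def y_def by algebra
  then show "?L2 = ?R2" by (simp only: E mult_zero_right add_0_right right_minus_eq)
  have "?L1 - ?R1 = (b - c) * (d - b) * (c^2 - 2*b^2 + a^2 - 2)"
    unfolding phi_p1_def phi_p2_def prod.case e_def g_def y_def by algebra
  then show "?L1 = ?R1" by (simp only: E mult_zero_right add_0_right right_minus_eq)
  have "?L3 - ?R3 = (b - c) * (2*c - b - d) * (c^2 - 2*b^2 + a^2 - 2)"
    unfolding phi_p3_def phi_p2_def prod.case e_def g_def y_def by algebra
  then show "?L3 = ?R3" by (simp only: E mult_zero_right add_0_right right_minus_eq)
  have "?L4 - ?R4 = (b - c) * (2*c - b - d) * (c^2 - 2*b^2 + a^2 - 2)"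
    unfolding phi_p4_def phi_p2_def prod.case e_def g_def y_def by algebra
  then show "?L4 = ?R4" by (simp only: E mult_zero_right add_0_right right_minus_eq)
qed

text \<open>
  The parametrization of \<open>X4\<close> away from \<open>e = 0\<close> by \<open>e = a - 2b + c\<close>, \<open>g = b - 2c + d\<close>,
  \<open>y = c - b\<close>: the first defining equation is linear in \<open>b\<close> in these coordinates.
\<close>

definition fib :: "complex \<Rightarrow> complex \<Rightarrow> complex \<Rightarrow> pt" where
  "fib e g y = (let b = (2 - y^2 - (e - y)^2) / (2*e) in (b - y + e, b, b + y, b + 2*y + g))"

lemma chart_in_X4:
  "(b - y + e, b, b + y, b + 2*y + g) \<in> X4 \<longleftrightarrow>
     2*b*e + y^2 + (e - y)^2 = 2 \<and> 2*b*g + (2*y + g)^2 - 2*y^2 = 2"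
  by (auto simp: X4_def power2_eq_square algebra_simps)

text \<open>\<open>fib\<close> chooses \<open>b\<close> to solve the first equation of the chart.
  Inserting this \<open>b\<close> into the second and clearing \<open>2*e\<close> leaves the
  quadratic for \<open>y\<close>.\<close>

lemma fib_in_X4:
  assumes "e \<noteq> 0"
  shows "fib e g y \<in> X4 \<longleftrightarrow> (g - e) * (2*y^2 - e*g - 2) = 6*e*g*y"
proof -
  define b where "b = (2 - y^2 - (e - y)^2) / (2*e)"
  have b': "2*e*b = 2 - y^2 - (e - y)^2" using assms by (simp add: b_def)
  then have b: "2*b*e + y^2 + (e - y)^2 = 2" by algebra
  have "2*e*(2*b*g + (2*y + g)^2 - 2*y^2 - 2) = 2 * (6*e*g*y - (g - e) * (2*y^2 - e*g - 2))"
    using b' by algebra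
  then have "2*b*g + (2*y + g)^2 - 2*y^2 = 2 \<longleftrightarrow> 6*e*g*y - (g - e) * (2*y^2 - e*g - 2) = 0"
    using assms by (metis mult_eq_0_iff eq_iff_diff_eq_0 zero_neq_numeral)
  then show ?thesis using b chart_in_X4[of b y e g] by (auto simp: fib_def Let_def b_def[symmetric])
qed

lemma X4_fib:
  assumes "(a, b, c, d) \<in> X4" "a - 2*b + c \<noteq> 0"
  shows "(a, b, c, d) = fib (a - 2*b + c) (b - 2*c + d) (c - b)"
proof -
  define e g y where "e = a - 2*b + c" and "g = b - 2*c + d" and "y = c - b"
  then have x: "(a, b, c, d) = (b - y + e, b, b + y, b + 2*y + g)" by simp
  then have "2*b*e + y^2 + (e - y)^2 = 2" using assms(1) chart_in_X4[of b y e g] by simp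
  then have "2 - y^2 - (e - y)^2 = b * (2*e)" by (simp add: diff_eq_eq ac_simps)
  moreover have "e \<noteq> 0" using assms(2) by (simp add: e_def)
  ultimately have "(2 - y^2 - (e - y)^2) / (2*e) = b" by simp
  then have "(b - y + e, b, b + y, b + 2*y + g) = fib e g y" by (simp add: fib_def Let_def)
  then show ?thesis unfolding x e_def g_def y_def .
qed

lemma phi_fib:
  assumes "fib e g y \<in> X4" "e \<noteq> 0" "y \<noteq> 0"
  shows "phi (fib e g y) = Some (fib e g (- (e*g + 2) / (2*y)))"
proof -
  define b where "b = (2 - y^2 - (e - y)^2) / (2*e)"
  define z where "z = - (e*g + 2) / (2*y)"
  define b' where "b' = (2 - z^2 - (e - z)^2) / (2*e)"
  let ?x = "(b - y + e, b, b + y, b + 2*y + g)"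
  have x: "fib e g y = ?x" by (simp add: fib_def b_def Let_def)
  have X: "?x \<in> X4" using assms(1) x by simp
  have h: "e*g + 2 = - 2*y*z" using assms by (simp add: z_def)
  have b': "2*e*b' = 2 - z^2 - (e - z)^2" using assms by (simp add: b'_def)
  have q: "phi_q ?x = y^2 * e" by (simp add: phi_q_def)
  have "b - y + e - 2*b + (b + y) = e" "b - 2*(b + y) + (b + 2*y + g) = g" "b + y - b = y" by simp_all
  note p = phi_p_diff[OF X, unfolded this h]
  have p2: "phi_p2 ?x = b' * phi_q ?x" using p(1) b' unfolding q by algebra
  moreover have "phi_p1 ?x = (b' - z + e) * phi_q ?x" using p(2) unfolding p2 q by algebra
  moreover have "phi_p3 ?x = (b' + z) * phi_q ?x" using p(3) unfolding p2 q by algebra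
  moreover have "phi_p4 ?x = (b' + 2*z + g) * phi_q ?x" using p(4) unfolding p2 q by algebra
  moreover have "phi_q ?x \<noteq> 0" using assms q by simp
  ultimately have "phi ?x = Some (b' - z + e, b', b' + z, b' + 2*z + g)"
    using X by (simp add: phi_def)
  then show ?thesis unfolding x by (simp add: fib_def Let_def b'_def z_def)
qed

text \<open>Multiplied by \<open>2*y^2\<close>, the quadratic expression at \<open>z\<close> becomes
  \<open>-(e*g + 2)\<close> times the one at \<open>y\<close>. This avoids dividing by the leading
  coefficient, a multiple of \<open>g - e\<close>.\<close>

lemma phi_fib_in_X4:
  assumes "fib e g y \<in> X4" "e \<noteq> 0" "y \<noteq> 0"
  shows "fib e g (- (e*g + 2) / (2*y)) \<in> X4"
proof -
  define z where "z = - (e*g + 2) / (2*y)"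
  have h: "2*y*z = - (e*g + 2)" using assms by (simp add: z_def)
  have "(g - e) * (2*y^2 - e*g - 2) = 6*e*g*y" using assms fib_in_X4 by blast
  then have "2*y^2 * ((g - e) * (2*z^2 - e*g - 2) - 6*e*g*z) = 0" using h by algebra
  then have "(g - e) * (2*z^2 - e*g - 2) = 6*e*g*z" using assms(3) by simp
  then show ?thesis using fib_in_X4[OF assms(2)] by (simp add: z_def)
qed

section \<open>Closure and continuity of rational polynomials\<close>

lemma ratpoly_projections [intro]: "(\<lambda>x. fst x) \<in> ratpoly" "(\<lambda>x. fst (snd x)) \<in> ratpoly"
  "(\<lambda>x. fst (snd (snd x))) \<in> ratpoly" "(\<lambda>x. snd (snd (snd x))) \<in> ratpoly"
  by (rule ratpoly.coord, auto simp: coords_def fun_eq_iff)+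

lemma ratpoly_numeral: "(\<lambda>_. numeral k) \<in> ratpoly"
  using ratpoly.const[of "numeral k"] by simp

lemma ratpoly_uminus:
  assumes "p \<in> ratpoly" shows "(\<lambda>x. - p x) \<in> ratpoly"
  using ratpoly.mult[OF ratpoly.const[of "- 1"] assms] by simp

lemma ratpoly_diff: "p \<in> ratpoly \<Longrightarrow> q \<in> ratpoly \<Longrightarrow> (\<lambda>x. p x - q x) \<in> ratpoly"
  using ratpoly.add[OF _ ratpoly_uminus] by simp

lemma ratpoly_power: "p \<in> ratpoly \<Longrightarrow> (\<lambda>x. p x ^ n) \<in> ratpoly"
proof (induction n)
  case 0
  then show ?case using ratpoly.const[of 1] by simp
qed (simp add: ratpoly.mult)

lemmas ratpoly_intros = ratpoly.add ratpoly.mult ratpoly_projections ratpoly_numeral ratpoly_uminus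
  ratpoly_diff ratpoly_power

lemma phi_ratpoly: "phi_q \<in> ratpoly" "phi_p1 \<in> ratpoly" "phi_p2 \<in> ratpoly" "phi_p3 \<in> ratpoly"
  "phi_p4 \<in> ratpoly"
  unfolding phi_q_def phi_p1_def phi_p2_def phi_p3_def phi_p4_def case_prod_beta
  by (intro ratpoly_intros)+

lemma continuous_ratpoly:
  assumes "p \<in> ratpoly" shows "continuous_on UNIV p"
  using assms
proof induction
  case (coord u)
  then show ?case
    by (auto simp: coords_def case_prod_beta intro!: continuous_intros)
qed (auto intro!: continuous_intros)

section \<open>Density of open sets in \<open>X4\<close>\<close>

text \<open>Of the two roots of \<open>w\<close>, the one \<open>s\<close> closer to
  \<open>r\<close> satisfies \<open>|s - r|^2 <= |s - r| * |s + r| = |w - r^2|\<close>. No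
  continuous branch is chosen, so \<open>r = 0\<close> is covered; the limit along full
  \<open>nhds\<close> composes freely.\<close>

lemma complex_sqrt_near:
  fixes r :: complex
  obtains f where "\<And>w. (f w)^2 = w" "(f \<longlongrightarrow> r) (nhds (r^2))"
proof -
  have "\<exists>s. s^2 = w \<and> (norm (s - r))^2 \<le> norm (w - r^2)" for w
  proof -
    let ?s = "csqrt w"
    have "(?s - r) * (?s + r) = ?s^2 - r^2" by algebra
    then have m: "norm (?s - r) * norm (?s + r) = norm (w - r^2)"
      by (simp flip: norm_mult)
    have "norm (- ?s - r) = norm (?s + r)" by (metis norm_minus_cancel minus_diff_eq diff_minus_eq_add add.commute)
    then have "\<exists>s. s^2 = w \<and> norm (s - r) * norm (s - r) \<le> norm (?s - r) * norm (?s + r)"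
    proof (cases "norm (?s - r) \<le> norm (?s + r)")
      case True
      then show ?thesis by (intro exI[of _ ?s]) (simp add: mult_left_mono)
    next
      case False
      then have "norm (- ?s - r) * norm (- ?s - r) \<le> norm (?s - r) * norm (?s + r)"
        unfolding \<open>norm (- ?s - r) = norm (?s + r)\<close> by (intro mult_right_mono) auto
      then show ?thesis by (intro exI[of _ "- ?s"]) simp
    qed
    then show ?thesis by (simp add: m flip: power2_eq_square)
  qed
  then obtain f where f: "\<And>w. (f w)^2 = w" "\<And>w. (norm (f w - r))^2 \<le> norm (w - r^2)"
    by metis
  have "((\<lambda>w. sqrt (norm (w - r^2))) \<longlongrightarrow> 0) (nhds (r^2))"
    using tendsto_real_sqrt[OF tendsto_norm[OF tendsto_diff[OF filterlim_ident[of "nhds (r^2)"] tendsto_const[of "r^2"]]]]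
    by simp
  moreover have "norm (f w - r) \<le> sqrt (norm (w - r^2))" for w
    using f(2) by (rule real_le_rsqrt)
  ultimately have "((\<lambda>w. f w - r) \<longlongrightarrow> 0) (nhds (r^2))"
    by (elim Lim_null_comparison[rotated]) simp
  then show thesis using f(1) by (intro that[of f]) (auto simp: LIM_zero_iff)
qed

text \<open>
  Near a given point of \<open>X4\<close> there are infinitely many others with the same first coordinate:
  move \<open>b^2\<close> and choose the square roots for \<open>b, c, d\<close> close to the given ones. Since
  polynomials are continuous, classical perturbation yields Zariski density.
\<close>

lemma dense_open_X4I:
  assumes U: "openin (zariski X4) U" and fin: "\<And>a. finite {b. \<exists>c d. (a, b, c, d) \<in> X4 - U}"
  shows "dense_open X4 U"
  unfolding dense_open_iff
proof (intro conjI allI impI U)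
  fix T assume T: "openin (zariski X4) T \<and> T \<noteq> {}"
  then obtain P where P: "P \<subseteq> ratpoly" "T = {x \<in> X4. \<exists>p\<in>P. p x \<noteq> 0}"
    unfolding openin_zariski by (elim conjE exE)
  from T obtain x0 where "x0 \<in> T" by blast
  then obtain a b c d where x: "(a, b, c, d) \<in> T" by (cases x0) blast
  then obtain p where p: "p \<in> ratpoly" "p \<in> P" "p (a, b, c, d) \<noteq> 0"
    using P(1) unfolding P(2) by blast
  have "d^2 - 2*c^2 + b^2 = 2" and c: "c^2 - 2*b^2 + a^2 = 2"
    using x P(2) by (auto simp: X4_def)
  then have d: "d^2 = 2*c^2 - b^2 + 2" by (simp add: algebra_simps)
  from c have c: "c^2 = 2*b^2 - a^2 + 2" by (simp add: algebra_simps)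
  with d have X: "c^2 = 2*b^2 - a^2 + 2" "d^2 = 3*b^2 - 2*a^2 + 6" by simp_all
  obtain f where f: "\<And>w. (f w)^2 = w" "(f \<longlongrightarrow> b) (nhds (b^2))" using complex_sqrt_near[of b] by blast
  obtain g where g: "\<And>w. (g w)^2 = w" "(g \<longlongrightarrow> c) (nhds (c^2))" using complex_sqrt_near[of c] by blast
  obtain h where h: "\<And>w. (h w)^2 = w" "(h \<longlongrightarrow> d) (nhds (d^2))" using complex_sqrt_near[of d] by blast
  \<comment> \<open>For fixed \<open>a\<close>, the squares of \<open>c\<close> and \<open>d\<close>
    on \<open>X4\<close> are affine functions of \<open>w = b^2\<close>, as recorded in
    \<open>X\<close>.\<close>
  define z where "z w = (a, f w, g (2*w - a^2 + 2), h (3*w - 2*a^2 + 6))" for w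
  have zX: "z w \<in> X4" for w by (simp add: z_def X4_def f g h)
  have "((\<lambda>w. 2*w - a^2 + 2) \<longlongrightarrow> c^2) (at (b^2))" "((\<lambda>w. 3*w - 2*a^2 + 6) \<longlongrightarrow> d^2) (at (b^2))"
    unfolding X by (intro tendsto_intros)+
  then have "(z \<longlongrightarrow> (a, b, c, d)) (at (b^2))"
    unfolding z_def
    by (intro tendsto_Pair tendsto_const filterlim_compose[OF g(2)] filterlim_compose[OF h(2)]
        tendsto_mono[OF _ f(2)]) (auto simp: at_within_le_nhds)
  then have "((\<lambda>w. p (z w)) \<longlongrightarrow> p (a, b, c, d)) (at (b^2))"
    using continuous_on_tendsto_compose[OF continuous_ratpoly[OF p(1)]] by simp
  then have "\<forall>\<^sub>F w in at (b^2). p (z w) \<noteq> 0" using p(3) by (rule tendsto_imp_eventually_ne)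
  \<comment> \<open>The parameters \<open>w\<close> to avoid: the squares of the finitely many bad
    values of \<open>b\<close> in this slice.\<close>
  moreover define S where "S = (\<lambda>b. b^2) ` {b. \<exists>c d. (a, b, c, d) \<in> X4 - U}"
  have "finite S" unfolding S_def by (intro finite_imageI fin)
  then have "\<not> (b^2) islimpt S" by (rule islimpt_finite)
  then have "\<forall>\<^sub>F w in at (b^2). w \<notin> S" by (simp add: islimpt_iff_eventually)
  ultimately have "\<forall>\<^sub>F w in at (b^2). z w \<in> U \<inter> T"
  proof eventually_elim
    case (elim w)
    then have "z w \<in> T" using zX p P by auto
    moreover have "z w \<in> U"
    proof (rule ccontr)
      assume "z w \<notin> U"
      then have "f w \<in> {b. \<exists>c d. (a, b, c, d) \<in> X4 - U}" using zX[of w] unfolding z_def by blast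
      then show False using elim(2) f(1)[of w] unfolding S_def by force
    qed
    ultimately show ?case by blast
  qed
  then show "U \<inter> T \<noteq> {}" using eventually_happens' trivial_limit_at by blast
qed

text \<open>The factors say that \<open>phi\<close> is defined at the point (\<open>e, y \<noteq> 0\<close>) and again at its image.\<close>

definition fib_good :: "pt \<Rightarrow> complex" where
  "fib_good = (\<lambda>(a, b, c, d). (a - 2*b + c) * (c - b) * ((a - 2*b + c) * (b - 2*c + d) + 2))"

text \<open>The bad locus splits into \<open>e = 0\<close>, \<open>y = 0\<close> and
  \<open>e*g = -2\<close>. On the slice these give \<open>b = a + 1\<close> or
  \<open>b = a - 1\<close>, \<open>b^2 = a^2 - 2\<close>, and finitely many values of
  \<open>e\<close>, respectively.\<close>

lemma finite_X4_slice_bad: "finite {b. \<exists>c d. (a, b, c, d) \<in> X4 \<and> fib_good (a, b, c, d) = 0}"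
proof -
  \<comment> \<open>\<open>P\<close> is what remains on \<open>e*g = -2\<close> after eliminating
    \<open>y = 6*e / (2 + e^2)\<close> from the first equation. Its constant term is 8, so it is
    nonzero for every \<open>a\<close>.\<close>
  define P where "P = [:2, 0, 1:]^3 - [:0, 0, 72:] - [:0, 2*a:] * [:2, 0, 1:]^2"
  have "poly P 0 \<noteq> 0" by (simp add: P_def)
  then have "finite {e. poly P e = 0}" by (intro poly_roots_finite) auto
  then have fin: "finite ({a + 1, a - 1} \<union> {csqrt (a^2 - 2), - csqrt (a^2 - 2)}
      \<union> (\<lambda>e. a - e + 6*e / (2 + e^2)) ` {e. poly P e = 0})" (is "finite ?S")
    by simp
  have "b \<in> ?S" if X: "(a, b, c, d) \<in> X4" and bad: "fib_good (a, b, c, d) = 0" for b c d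
  proof -
    define e g y where "e = a - 2*b + c" and "g = b - 2*c + d" and "y = c - b"
    have x: "(a, b, c, d) = (b - y + e, b, b + y, b + 2*y + g)"
      by (simp add: e_def g_def y_def)
    have eqs: "2*b*e + y^2 + (e - y)^2 = 2" "2*b*g + (2*y + g)^2 - 2*y^2 = 2"
      using X unfolding x chart_in_X4 by auto
    have ab: "a = b - y + e" using x by simp
    from bad consider "e = 0" | "y = 0" | "e \<noteq> 0" "y \<noteq> 0" "e*g + 2 = 0"
      by (auto simp: fib_good_def e_def g_def y_def)
    then show ?thesis
    proof cases
      case 1
      then have "y^2 = 1" using eqs(1) by simp
      then show ?thesis using ab 1 by (auto simp: power2_eq_1_iff)
    next
      case 2
      then have "b^2 = a^2 - 2" using X by (simp add: y_def X4_def algebra_simps)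
      then have "b = csqrt (a^2 - 2) \<or> b = - csqrt (a^2 - 2)" by (metis power2_csqrt power2_eq_iff)
      then show ?thesis by blast
    next
      \<comment> \<open>On this curve \<open>y\<close>, and then \<open>a\<close> and \<open>b\<close>, are rational functions of \<open>e\<close>.\<close>
      case 3
      have "(g - e) * (2*y^2 - e*g - 2) = 6*e*g*y"
        using fib_in_X4[OF 3(1), of g y] X4_fib[OF X 3(1)[unfolded e_def]] X
        unfolding e_def[symmetric] g_def[symmetric] y_def[symmetric] by simp
      then have "4*y * ((2 + e^2) * y - 6*e) = 0" using 3(3) by algebra
      then have y: "(2 + e^2) * y = 6*e" using 3(2) by simp
      then have "2 + e^2 \<noteq> 0" using 3(1) by auto
      then have "y = 6*e / (2 + e^2)" using y by (simp add: eq_divide_eq mult.commute)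
      moreover have "2*a*e + 2*y^2 - e^2 = 2"
        using eqs(1) unfolding ab by (simp add: power2_eq_square algebra_simps)
      then have "2*a*e = 2 - 2*y^2 + e^2" by (simp add: algebra_simps)
      then have "(2 + e^2)^3 - 72*e^2 - 2*e*a*(2 + e^2)^2 = 0" using y by algebra
      then have "poly P e = 0" by (simp add: P_def power2_eq_square algebra_simps)
      moreover have "b = a - e + y" using ab by simp
      ultimately show ?thesis by blast
    qed
  qed
  then have "{b. \<exists>c d. (a, b, c, d) \<in> X4 \<and> fib_good (a, b, c, d) = 0} \<subseteq> ?S" by blast
  then show ?thesis using fin finite_subset by blast
qed

lemma dense_fib_good: "dense_open X4 {x \<in> X4. fib_good x \<noteq> 0}"
proof (rule dense_open_X4I)
  have "fib_good \<in> ratpoly"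
    unfolding fib_good_def case_prod_beta by (intro ratpoly_intros)
  then show "openin (zariski X4) {x \<in> X4. fib_good x \<noteq> 0}" by (rule open_nonzero)
  show "finite {b. \<exists>c d. (a, b, c, d) \<in> X4 - {x \<in> X4. fib_good x \<noteq> 0}}" for a
    by (rule finite_subset[OF _ finite_X4_slice_bad[of a]]) auto
qed

lemma fib_goodD:
  assumes "x \<in> X4" "fib_good x \<noteq> 0"
  obtains e g y where "x = fib e g y" "e \<noteq> 0" "y \<noteq> 0" "e*g + 2 \<noteq> 0"
proof -
  obtain a b c d where x: "x = (a, b, c, d)" by (cases x) blast
  have "a - 2*b + c \<noteq> 0" "c - b \<noteq> 0" "(a - 2*b + c) * (b - 2*c + d) + 2 \<noteq> 0"
    using assms(2) unfolding x fib_good_def by auto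
  then show thesis using that X4_fib[of a b c d] assms(1) unfolding x by blast
qed

section \<open>Birationality of \<open>phi\<close>, \<open>tau\<close> and
  \<open>mu14\<close>\<close>

lemma dom_phi: "dom phi = {x \<in> X4. phi_q x \<noteq> 0}"
  by (auto simp: phi_def)

lemma coords_cases:
  assumes "u \<in> coords"
  shows "u = fst \<or> u = (\<lambda>x. fst (snd x)) \<or> u = (\<lambda>x. fst (snd (snd x))) \<or> u = (\<lambda>x. snd (snd (snd x)))"
  using assms by (auto simp: coords_def fun_eq_iff)

lemma rat_rep_phi: "rat_rep X4 phi"
  unfolding rat_rep_def
proof (intro conjI ballI)
  have op: "openin (zariski X4) (dom phi)"
    unfolding dom_phi by (rule open_nonzero[OF phi_ratpoly(1)])
  have "phi_q x \<noteq> 0" if "fib_good x \<noteq> 0" for x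
    using that by (cases x) (auto simp: fib_good_def phi_q_def)
  then show "dense_open X4 (dom phi)"
    by (intro dense_open_mono[OF dense_fib_good op]) (auto simp: dom_phi)
  have "the (phi x) \<in> X4" if "x \<in> dom phi" for x
  proof -
    obtain a b c d where x: "x = (a, b, c, d)" by (cases x) blast
    have X: "(a, b, c, d) \<in> X4" and q: "phi_q (a, b, c, d) \<noteq> 0" using that x by (auto simp: dom_phi)
    then have "a - 2*b + c \<noteq> 0" "c - b \<noteq> 0" by (auto simp: phi_q_def)
    then obtain e g y where x: "x = fib e g y" "e \<noteq> 0" "y \<noteq> 0"
      using X4_fib[OF X] x by blast
    have "fib e g y \<in> X4" using that x(1) by (simp add: dom_phi)
    then show ?thesis using phi_fib[of e g y] phi_fib_in_X4[of e g y] x by simp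
  qed
  then show "ran phi \<subseteq> X4" by (force simp: ran_def)
  fix u :: "pt \<Rightarrow> complex" assume "u \<in> coords"
  have reg: "regular_fun X4 (dom phi) v"
    if "p \<in> ratpoly" "\<And>x. x \<in> dom phi \<Longrightarrow> p x / phi_q x = v x" for p v
    by (rule regular_cong[OF regular_divide[OF regular_ratpoly[OF op that(1)]
            regular_ratpoly[OF op phi_ratpoly(1)]] that(2)]) (simp_all add: dom_phi)
  have "the (phi x) = (phi_p1 x / phi_q x, phi_p2 x / phi_q x, phi_p3 x / phi_q x, phi_p4 x / phi_q x)"
    if "x \<in> dom phi" for x
    using that by (simp add: phi_def dom_phi)
  then show "regular_fun X4 (dom phi) (\<lambda>x. u (the (phi x)))"
    using coords_cases[OF \<open>u \<in> coords\<close>] reg[OF phi_ratpoly(2)] reg[OF phi_ratpoly(3)]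
      reg[OF phi_ratpoly(4)] reg[OF phi_ratpoly(5)]
    by (elim disjE) simp_all
qed

lemma phi_involution:
  assumes "x \<in> X4" "fib_good x \<noteq> 0" shows "(phi \<circ>\<^sub>m phi) x = Some x"
proof -
  obtain e g y where x: "x = fib e g y" and nz: "e \<noteq> 0" "y \<noteq> 0" "e*g + 2 \<noteq> 0"
    using fib_goodD[OF assms] .
  define z where "z = - (e*g + 2) / (2*y)"
  have z: "z \<noteq> 0" "- (e*g + 2) / (2*z) = y" proof -
    \<comment> \<open>Treating \<open>e*g + 2\<close> as an atom lets simplification cancel it. That
      it is nonzero makes \<open>z\<close> nonzero, so \<open>phi\<close> applies a second
      time.\<close>
    define h where "h = e*g + 2"
    have "h \<noteq> 0" "z = - h / (2*y)" using nz by (simp_all add: h_def z_def)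
    then show "z \<noteq> 0" "- (e*g + 2) / (2*z) = y" using nz(2) by (simp_all flip: h_def)
  qed
  have "phi x = Some (fib e g z)" "fib e g z \<in> X4"
    using phi_fib[of e g y] phi_fib_in_X4[of e g y] nz assms(1) unfolding x z_def by auto
  then show ?thesis using phi_fib[of e g z] z nz(1) by (simp add: x)
qed

lemma rat_inverse_phi: "rat_inverse X4 phi phi"
  unfolding rat_inverse_def
  using rat_rep_phi dense_fib_good phi_involution
  by (intro conjI exI[of _ "{x \<in> X4. fib_good x \<noteq> 0}"]) auto

lemma rat_inverse_polynomial_involution:
  assumes f: "\<And>x. x \<in> X \<Longrightarrow> f x \<in> X" "\<And>x. f (f x) = x"
    and u: "\<And>u. u \<in> coords \<Longrightarrow> (\<lambda>x. u (f x)) \<in> ratpoly"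
  shows "rat_inverse X ((\<lambda>x. Some (f x)) |` X) ((\<lambda>x. Some (f x)) |` X)"
proof -
  let ?f = "(\<lambda>x. Some (f x)) |` X"
  have dom: "dom ?f = X" by auto
  have "regular_fun X X (\<lambda>x. v (the (?f x)))" if "v \<in> coords" for v
    by (rule regular_cong[OF regular_ratpoly[OF _ u[OF that]]])
       (use dense_open_X in \<open>auto simp: dense_open_def\<close>)
  moreover have "ran ?f \<subseteq> X"
  proof
    fix y assume "y \<in> ran ?f"
    then obtain x where "?f x = Some y" unfolding ran_def by blast
    then have "x \<in> X" "y = f x" by (cases "x \<in> X"; simp)+
    then show "y \<in> X" using f(1) by blast
  qed
  ultimately have "rat_rep X ?f" unfolding rat_rep_def dom using dense_open_X by blast
  then show ?thesis unfolding rat_inverse_def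
    using dense_open_X f by (intro conjI exI[of _ X] ballI) simp_all
qed

lemma rat_inverse_tau: "rat_inverse X4 tau tau"
proof -
  let ?f = "\<lambda>(a, b, c, d). (d, c, b, a) :: pt"
  have "rat_inverse X4 ((\<lambda>x. Some (?f x)) |` X4) ((\<lambda>x. Some (?f x)) |` X4)"
    by (rule rat_inverse_polynomial_involution)
       (auto simp: X4_def algebra_simps case_prod_beta dest!: coords_cases)
  also have "(\<lambda>x. Some (?f x)) |` X4 = tau" by (auto simp: tau_def restrict_map_def fun_eq_iff)
  finally show ?thesis .
qed

lemma rat_inverse_mu14: "rat_inverse X4 mu14 mu14"
proof -
  let ?f = "\<lambda>(a, b, c, d). (- a, b, c, - d) :: pt"
  have "rat_inverse X4 ((\<lambda>x. Some (?f x)) |` X4) ((\<lambda>x. Some (?f x)) |` X4)"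
    by (rule rat_inverse_polynomial_involution)
       (auto simp: X4_def case_prod_beta intro!: ratpoly_intros dest!: coords_cases)
  also have "(\<lambda>x. Some (?f x)) |` X4 = mu14" by (auto simp: mu14_def restrict_map_def fun_eq_iff)
  finally show ?thesis .
qed

section \<open>Powers of classes, and comparison of representatives at a point\<close>

text \<open>A concrete representative of a power, which can be evaluated at points. The new factor
  stands on the right, as in the recursion for \<open>[^]\<close>.\<close>

primrec iter :: "pt set \<Rightarrow> (pt \<rightharpoonup> pt) \<Rightarrow> nat \<Rightarrow> pt \<rightharpoonup> pt" where
  "iter X f 0 = Some |` X"
| "iter X f (Suc n) = iter X f n \<circ>\<^sub>m f"

lemma iter_rep: "rat_inverse X f f' \<Longrightarrow> rat_rep X (iter X f n)"
  by (induction n) (auto intro: Some_rep comp_rep)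

lemma Bir_pow:
  assumes "rat_inverse X f f'"
  shows "rat_class X f [^]\<^bsub>Bir X\<^esub> n = rat_class X (iter X f n)"
proof (induction n)
  case 0
  then show ?case by (simp add: Bir_def rat_id_def)
next
  case (Suc n)
  have "rat_class X f [^]\<^bsub>Bir X\<^esub> Suc n = rat_comp X (rat_class X (iter X f n)) (rat_class X f)"
    using Suc by (simp add: Bir_def)
  then show ?case using rat_comp_class[OF iter_rep[OF assms] assms] by simp
qed

text \<open>If the values differed, so would some coordinate. The difference of that coordinate is
  regular on the common domain, so its nonvanishing locus is open and nonempty and meets the dense
  set of agreement.\<close>

lemma rat_eq_agree:
  assumes "(f, g) \<in> rat_eq X" "f x = Some x'" "g x = Some x''"
  shows "x' = x''"
proof (rule ccontr)
  assume "x' \<noteq> x''"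
  then have "\<exists>u\<in>coords. u x' \<noteq> u x''" by (cases x'; cases x'') (auto simp: coords_def)
  then obtain u where u: "u \<in> coords" "u x' \<noteq> u x''" by blast
  obtain W where f: "rat_rep X f" and g: "rat_rep X g" and W: "dense_open X W" "\<And>x. x \<in> W \<Longrightarrow> f x = g x"
    using assms(1) by (elim rat_eqE) blast
  define D where "D = dom f \<inter> dom g"
  \<comment> \<open>Subtraction is written with the constant -1 so that closure of regular functions
    under sums and products suffices.\<close>
  define h where "h = (\<lambda>x. u (the (f x)) + of_rat (- 1) * u (the (g x)))"
  have D: "openin (zariski X) D" unfolding D_def using rat_repD(2) f g by blast
  have "regular_fun X D (\<lambda>x. u (the (f x)))" "regular_fun X D (\<lambda>x. u (the (g x)))"
    using rat_repD(4)[OF f u(1)] rat_repD(4)[OF g u(1)] regular_restrict[OF _ D]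
    unfolding D_def by blast+
  then have "regular_fun X D h"
    unfolding h_def by (intro regular_add regular_mult regular_ratpoly[OF D ratpoly.const])
  then have "openin (zariski X) {x \<in> D. h x \<noteq> 0}" by (rule open_regular_nonzero)
  moreover have "x \<in> {x \<in> D. h x \<noteq> 0}" using assms(2,3) u(2) by (simp add: D_def h_def domI)
  ultimately have "W \<inter> {x \<in> D. h x \<noteq> 0} \<noteq> {}" using W(1) unfolding dense_open_iff by blast
  then obtain w where "w \<in> W" "h w \<noteq> 0" by blast
  then show False using W(2)[of w] by (simp add: h_def)
qed

section \<open>The orbit of \<open>zeta\<close> on the line\<close>

definition zeta_map :: "pt \<rightharpoonup> pt" where
  "zeta_map = phi \<circ>\<^sub>m tau \<circ>\<^sub>m mu14"

lemma zeta_inverse: "\<exists>h. rat_inverse X4 zeta_map h"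
  unfolding zeta_map_def
  using rat_inverse_comp[OF rat_inverse_comp[OF rat_inverse_phi rat_inverse_tau] rat_inverse_mu14] by blast

lemma zeta_eq: "zeta = rat_class X4 zeta_map"
proof -
  have "rat_rep X4 (phi \<circ>\<^sub>m tau)" by (rule comp_rep[OF rat_rep_phi rat_inverse_tau])
  then show ?thesis
    unfolding zeta_def zeta_map_def
    using rat_comp_class[OF rat_rep_phi rat_inverse_tau] rat_comp_class[OF _ rat_inverse_mu14]
    by (simp add: Bir_def)
qed

definition line_pt :: "complex \<Rightarrow> pt" where
  "line_pt x = (- x, x + 1, x + 2, x + 3)"

lemma line_pt_in_X4: "line_pt x \<in> X4"
  by (simp add: line_pt_def X4_def power2_eq_square algebra_simps)

text \<open>\<open>mu14\<close> followed by \<open>tau\<close> sends the point to \<open>?x\<close>,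
  where \<open>phi_q\<close> equals \<open>- 2 * (x + 3)\<close>; the hypothesis says exactly that
  \<open>phi\<close> is defined there.\<close>

lemma zeta_line_pt:
  assumes "x + 3 \<noteq> 0" shows "zeta_map (line_pt x) = Some (line_pt (x + 3))"
proof -
  let ?x = "(- (x + 3), x + 2, x + 1, x)"
  have X: "(- x, x + 1, x + 2, x + 3) \<in> X4" "(x, x + 1, x + 2, - (x + 3)) \<in> X4" "?x \<in> X4"
    by (simp_all add: X4_def power2_eq_square algebra_simps)
  have q: "phi_q ?x = - 2 * (x + 3)" by (simp add: phi_q_def algebra_simps)
  have "phi_p1 ?x = - (x + 3) * phi_q ?x" "phi_p2 ?x = (x + 4) * phi_q ?x"
    "phi_p3 ?x = (x + 5) * phi_q ?x" "phi_p4 ?x = (x + 6) * phi_q ?x"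
    unfolding q
    by (simp_all add: phi_p1_def phi_p2_def phi_p3_def phi_p4_def power2_eq_square power3_eq_cube
        power4_eq_xxxx algebra_simps)
  moreover have "phi_q ?x \<noteq> 0" unfolding q using assms by (simp only: mult_eq_0_iff) simp
  ultimately have "phi ?x = Some (- (x + 3), x + 4, x + 5, x + 6)" using X(3) by (simp add: phi_def)
  then show ?thesis
    using X by (simp add: zeta_map_def line_pt_def mu14_def tau_def map_comp_def)
qed

lemma iter_zeta_line_pt:
  "iter X4 zeta_map n (line_pt (of_nat k)) = Some (line_pt (of_nat (k + 3*n)))"
\<comment> \<open>\<open>iter\<close> applies \<open>zeta_map\<close> first, which moves the start
  to \<open>k + 3\<close>, so \<open>k\<close> must vary. Natural parameters never reach the
  excluded value -3.\<close>
proof (induction n arbitrary: k)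
  case 0
  then show ?case by (simp add: line_pt_in_X4)
next
  case (Suc n)
  have "of_nat k + 3 = (of_nat (k + 3) :: complex)" by simp
  moreover from this have "of_nat k + 3 \<noteq> (0 :: complex)" by (simp only: of_nat_eq_0_iff)
  ultimately have "zeta_map (line_pt (of_nat k)) = Some (line_pt (of_nat (k + 3)))"
    using zeta_line_pt[of "of_nat k"] by simp
  then show ?case using Suc[of "k + 3"] by (simp add: algebra_simps)
qed

theorem lemma2p9:
  shows "zeta \<in> carrier (Bir X4) \<and>
    (\<forall>n::nat. n > 0 \<longrightarrow> zeta [^]\<^bsub>Bir X4\<^esub> n \<noteq> \<one>\<^bsub>Bir X4\<^esub>)"
proof (intro conjI allI impI notI)
  obtain h where h: "rat_inverse X4 zeta_map h" using zeta_inverse by blast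
  then show "zeta \<in> carrier (Bir X4)"
    using birational_iff zeta_eq by (auto simp: Bir_def)
  fix n :: nat assume "n > 0" and eq: "zeta [^]\<^bsub>Bir X4\<^esub> n = \<one>\<^bsub>Bir X4\<^esub>"
  have "rat_class X4 (iter X4 zeta_map n) = rat_class X4 (Some |` X4)"
    using eq Bir_pow[OF h, of n] by (simp add: zeta_eq Bir_def rat_id_def)
  then have "(iter X4 zeta_map n, Some |` X4) \<in> rat_eq X4"
    using rat_class_eq_iff[OF iter_rep[OF h] Some_rep] by blast
  then have "line_pt (of_nat (0 + 3*n)) = line_pt (of_nat 0)"
    by (rule rat_eq_agree[where f = "iter X4 zeta_map n" and x = "line_pt (of_nat 0)",
          OF _ iter_zeta_line_pt]) (simp add: line_pt_in_X4)
  then show False using \<open>n > 0\<close> by (simp add: line_pt_def)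
qed

end
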